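(* For every integer $n\ge 1$, the class $\mathcal{G}_n$ of all $n$-vertex graphs has an isometric-universal graph on at most $16^{n+O(\log n)}$ vertices.
   Context: A subgraph $G$ of $H$ is isometric if $d_G(u,v)=d_H(u,v)$ for all $u,v\in V(G)$ (distances possibly $\infty$); $H$ is isometric-universal for a class $\mathcal{C}$ if it contains an isometric copy of every $G\in\mathcal{C}$. The $O(\log n)$ term denotes a quantity bounded by $C\log n$ for an absolute constant $C$ (for $n\ge 2$). *)

theory Defs
  imports Complex_Main "Graph_Theory.Graph_Theory"
begin

text \<open>
  A finite simple graph is a member of the locale \<^locale>\<open>graph\<close>: a finite, symmetric,
  loop-free digraph without parallel arcs, so that an edge \<open>uv\<close> is the pair of opposite arcs
  \<open>u \<rightarrow> v\<close> and \<open>v \<rightarrow> u\<close>. Both \<^const>\<open>subgraph\<close> and \<^const>\<open>digraph_iso\<close> are the library notions;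
  a symmetric subgraph is the same thing as a subgraph in the undirected sense (not necessarily
  induced).
\<close>

text \<open>
  With unit arc costs the cost of a walk is its number of arcs. The infimum over the empty set of
  walks is \<open>\<infinity>\<close>.
\<close>

definition graph_dist :: "('a, 'b) pre_digraph \<Rightarrow> 'a \<Rightarrow> 'a \<Rightarrow> ereal" where
  "graph_dist G u v = wf_digraph.\<mu> G (\<lambda>_. 1) u v"

definition isometric_subgraph :: "('a, 'b) pre_digraph \<Rightarrow> ('a, 'b) pre_digraph \<Rightarrow> bool" where
  "isometric_subgraph G H \<longleftrightarrow> subgraph G H \<and>
     (\<forall>u \<in> verts G. \<forall>v \<in> verts G. graph_dist G u v = graph_dist H u v)"

definition has_isometric_copy :: "('a, 'b) pre_digraph \<Rightarrow> ('c, 'd) pre_digraph \<Rightarrow> bool" where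
  "has_isometric_copy H G \<longleftrightarrow> (\<exists>G'. digraph_iso G G' \<and> isometric_subgraph G' H)"

definition isometric_universal ::
  "('a, 'b) pre_digraph \<Rightarrow> ('c, 'd) pre_digraph set \<Rightarrow> bool" where
  "isometric_universal H \<C> \<longleftrightarrow> graph H \<and> (\<forall>G \<in> \<C>. has_isometric_copy H G)"

definition n_vertex_graphs :: "nat \<Rightarrow> ('a, 'b) pre_digraph set" where
  "n_vertex_graphs n = {G. graph G \<and> card (verts G) = n}"

text \<open>
  Graphs with natural numbers as vertices suffice to represent the class of all \<open>n\<close>-vertex graphs:
  a graph that is isometric-universal for those is so for the \<open>n\<close>-vertex graphs over any types
  of vertices and arcs.
\<close>

lemma graph_iso_nat_graph:
  fixes G :: "('a, 'b) pre_digraph"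
  assumes "G \<in> n_vertex_graphs n"
  obtains G0 :: "(nat, nat \<times> nat) pre_digraph"
  where "G0 \<in> n_vertex_graphs n" "digraph_iso G0 G"
proof -
  interpret graph G using assms by (simp add: n_vertex_graphs_def)
  obtain h :: "'a \<Rightarrow> nat" where h: "inj_on h (verts G)"
    using finite_imp_inj_to_nat_seg[OF finite_verts] by blast
  define f where "f = \<lparr>iso_verts = h, iso_arcs = (\<lambda>a. (h (tail G a), h (head G a))),
    iso_head = snd, iso_tail = fst\<rparr>"
  have arcs: "inj_on (\<lambda>a. (h (tail G a), h (head G a))) (arcs G)"
    by (rule inj_onI)
      (auto intro!: no_multi_arcs simp: arc_to_ends_def dest!: inj_onD[OF h])
  have f: "digraph_isomorphism f"
    using h arcs wf_digraph by (auto simp: digraph_isomorphism_def f_def)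
  have iso: "digraph_iso G (app_iso f G)"
    using f by (auto simp: digraph_iso_def)
  interpret H: fin_digraph "app_iso f G" using f by (rule fin_digraphI_app_iso)
  have "symmetric (app_iso f G)"
    using sym_arcs unfolding symmetric_def arcs_ends_app_iso_eq[OF f]
    by (auto simp: sym_def)
  moreover have "fst e \<noteq> snd e" if "e \<in> arcs (app_iso f G)" for e
    using that h no_loops by (auto simp: f_def dest!: inj_onD[OF h])
  ultimately have "graph (app_iso f G)"
    by unfold_locales (auto simp: f_def arc_to_ends_def)
  moreover have "card (verts (app_iso f G)) = n"
    using h assms by (simp add: f_def card_image n_vertex_graphs_def)
  ultimately show thesis
    using that[of "app_iso f G"] digraph_iso_swap[OF wf_digraph iso]
    by (simp add: n_vertex_graphs_def)
qed

lemma isometric_universal_any_type: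
  assumes "isometric_universal H (n_vertex_graphs n :: (nat, nat \<times> nat) pre_digraph set)"
  shows "isometric_universal H (n_vertex_graphs n :: ('c, 'd) pre_digraph set)"
  unfolding isometric_universal_def
proof (intro conjI ballI)
  show "graph H" using assms by (simp add: isometric_universal_def)
next
  fix G :: "('c, 'd) pre_digraph" assume "G \<in> n_vertex_graphs n"
  then obtain G0 :: "(nat, nat \<times> nat) pre_digraph"
    where G0: "G0 \<in> n_vertex_graphs n" "digraph_iso G0 G"
    by (rule graph_iso_nat_graph)
  interpret G0: graph G0 using G0(1) by (simp add: n_vertex_graphs_def)
  have "digraph_iso G G0"
    using G0.wf_digraph G0(2) by (rule digraph_iso_swap)
  moreover obtain G' where "digraph_iso G0 G'" "isometric_subgraph G' H"
    using assms G0(1) by (auto simp: isometric_universal_def has_isometric_copy_def)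
  ultimately show "has_isometric_copy H G"
    unfolding has_isometric_copy_def by (blast intro: digraph_iso_trans)
qed

end

theory Submission
  imports Defs
begin

text \<open>
  Let a connected \<open>n\<close>-vertex graph be traversed by a closed tour \<open>x\<^sub>0, \<dots>, x\<^sub>2\<^sub>n\<^sub>-\<^sub>2\<close> around a spanning
  tree, and label each vertex \<open>u\<close> with the vector of distances \<open>d(u, x\<^sub>i)\<close>. Adjacent vertices have
  labels at sup-distance at most 1, and since \<open>v\<close> occurs on the tour, the labels of \<open>u\<close> and \<open>v\<close>
  have sup-distance exactly \<open>d(u, v)\<close>. So the graph is isometric in the graph of all candidate
  labels, two of them being adjacent if their sup-distance is 1. Consecutive entries of a label
  differ by at most 1, which leaves \<open>n \<cdot> 9\<^sup>n\<^sup>-\<^sup>1\<close> candidates. A disjoint union of \<open>n\<close> copies of the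
  label graph takes care of disconnected graphs.
\<close>

section \<open>Hop distance\<close>

text \<open>A natural number, so that distances can serve as integer label entries.
  \<open>LEAST\<close> gives a meaningful value only when some walk exists, so reachability has to
  accompany its use.\<close>

definition (in pre_digraph) hops :: "'a \<Rightarrow> 'a \<Rightarrow> nat" where
  "hops u v = (LEAST k. \<exists>p. awalk u p v \<and> length p = k)"

context wf_digraph
begin

lemma hops_le_length: "awalk u p v \<Longrightarrow> hops u v \<le> length p"
  unfolding hops_def by (rule Least_le) blast

lemma hops_awalk:
  assumes "u \<rightarrow>\<^sup>* v"
  obtains p where "awalk u p v" "length p = hops u v"
proof -
  have "\<exists>k p. awalk u p v \<and> length p = k"
    using assms by (auto simp: reachable_awalk)
  then have "\<exists>p. awalk u p v \<and> length p = hops u v"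
    unfolding hops_def by (rule LeastI_ex)
  then show thesis using that by blast
qed

lemma hops_refl: "u \<in> verts G \<Longrightarrow> hops u u = 0"
  using hops_le_length[of u "[]" u] by (simp add: awalk_Nil_iff)

lemma hops_adj_left:
  assumes "u \<rightarrow>\<^bsub>G\<^esub> v" "v \<rightarrow>\<^sup>* x"
  shows "hops u x \<le> Suc (hops v x)"
proof -
  obtain p where p: "awalk v p x" "length p = hops v x"
    using assms(2) by (rule hops_awalk)
  obtain e where "e \<in> arcs G" "tail G e = u" "head G e = v"
    using assms(1) by (rule reachableE)
  then have "awalk u (e # p) x" using p by (simp add: awalk_Cons_iff)
  then show ?thesis using p(2) by (auto dest: hops_le_length)
qed

lemma hops_adj_right:
  assumes "u \<rightarrow>\<^sup>* x" "x \<rightarrow>\<^bsub>G\<^esub> y"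
  shows "hops u y \<le> Suc (hops u x)"
proof -
  obtain p where p: "awalk u p x" "length p = hops u x"
    using assms(1) by (rule hops_awalk)
  obtain e where e: "e \<in> arcs G" "tail G e = x" "head G e = y"
    using assms(2) by (rule reachableE)
  then have "awalk x [e] y" using arc_implies_awalk[of e] by simp
  then have "awalk u (p @ [e]) y" using p by (blast intro: awalk_appendI)
  then have "hops u y \<le> length (p @ [e])" by (rule hops_le_length)
  then show ?thesis using p(2) by simp
qed

end

text \<open>A path repeats no vertex, so it has fewer arcs than the graph has vertices. This puts
  the last entry of a label in \<open>{0..<int n}\<close>.\<close>

lemma (in fin_digraph) hops_less_card:
  assumes "u \<rightarrow>\<^sup>* v"
  shows "hops u v < card (verts G)"
proof -
  obtain p where p: "apath u p v" using assms by (auto simp: reachable_apath)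
  then have "awalk u p v" "distinct (awalk_verts u p)" by (auto simp: apath_def)
  then have "Suc (length p) \<le> card (verts G)"
    by (metis awalkE card_mono distinct_card finite_verts length_awalk_verts)
  with \<open>awalk u p v\<close> show ?thesis by (auto dest: hops_le_length)
qed

section \<open>Covering tours\<close>

text \<open>The tour is grown directly, without a spanning tree: a detour \<open>v, w, v\<close> to
  a new vertex \<open>w\<close> costs two entries. Once the component is exhausted, the tour is
  padded by repetition, so that its length is independent of the component; hence the case
  \<open>x = y\<close>.\<close>

lemma (in graph) ex_tour:
  assumes "r \<in> verts G"
  shows "\<exists>ws. length ws = Suc (2 * k) \<and> successively (\<lambda>x y. x = y \<or> x \<rightarrow>\<^bsub>G\<^esub> y) ws \<and> r \<in> set ws \<and>
    set ws \<subseteq> {x. r \<rightarrow>\<^sup>* x} \<and> (set ws = {x. r \<rightarrow>\<^sup>* x} \<or> k < card (set ws))"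
proof (induction k)
  case 0
  show ?case using assms by (intro exI[of _ "[r]"]) auto
next
  case (Suc k)
  then obtain ws where ws: "length ws = Suc (2 * k)"
    "successively (\<lambda>x y. x = y \<or> x \<rightarrow>\<^bsub>G\<^esub> y) ws" "r \<in> set ws" "set ws \<subseteq> {x. r \<rightarrow>\<^sup>* x}"
    "set ws = {x. r \<rightarrow>\<^sup>* x} \<or> k < card (set ws)"
    by blast
  show ?case
  proof (cases "set ws = {x. r \<rightarrow>\<^sup>* x}")
    case True
    obtain v vs where "ws = v # vs" using ws(1) by (cases ws) auto
    with ws True assms show ?thesis by (intro exI[of _ "v # v # ws"]) auto
  next
    case False
    \<comment> \<open>If no arc left \<open>set ws\<close>, then this set, which contains
      \<open>r\<close>, would be closed under reachability and hence be the whole component.\<close>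
    have "\<exists>v\<in>set ws. \<exists>w. w \<notin> set ws \<and> v \<rightarrow>\<^bsub>G\<^esub> w"
    proof (rule ccontr)
      assume closed: "\<not> ?thesis"
      have "y \<in> set ws" if "r \<rightarrow>\<^sup>* y" for y
        using that by (induction rule: reachable_induct) (use closed ws(3) in auto)
      with False ws(4) show False by auto
    qed
    then obtain v w where vw: "v \<in> set ws" "w \<notin> set ws" "v \<rightarrow>\<^bsub>G\<^esub> w" by blast
    have "w \<rightarrow>\<^bsub>G\<^esub> v" using vw(3) by (rule arcs_ends_symmetric[OF sym_arcs])
    obtain as bs where split: "ws = as @ v # bs" using vw(1) by (auto simp: in_set_conv_decomp)
    let ?ws = "as @ v # w # v # bs"
    have "set ?ws = insert w (set ws)" by (auto simp: split)
    moreover have "successively (\<lambda>x y. x = y \<or> x \<rightarrow>\<^bsub>G\<^esub> y) ?ws"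
      using ws(2) vw(3) \<open>w \<rightarrow>\<^bsub>G\<^esub> v\<close>
      unfolding split by (auto simp: successively_append_iff)
    moreover have "r \<rightarrow>\<^sup>* w" using ws(4) vw by (auto intro: reachable_adj_trans)
    ultimately show ?thesis
      using ws False vw(2) by (intro exI[of _ ?ws]) (auto simp: split)
  qed
qed

text \<open>For \<open>k = card (verts G) - 1\<close>, the second alternative of
  \<open>ex_tour\<close> forces every vertex onto the tour, so both alternatives give the component
  of \<open>r\<close>.\<close>

lemma (in graph) ex_covering_tour:
  assumes "r \<in> verts G"
  shows "\<exists>ws. length ws = Suc (2 * (card (verts G) - 1)) \<and>
    successively (\<lambda>x y. x = y \<or> x \<rightarrow>\<^bsub>G\<^esub> y) ws \<and> set ws = {x. r \<rightarrow>\<^sup>* x}"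
proof -
  obtain ws where ws: "length ws = Suc (2 * (card (verts G) - 1))"
    "successively (\<lambda>x y. x = y \<or> x \<rightarrow>\<^bsub>G\<^esub> y) ws" "set ws \<subseteq> {x. r \<rightarrow>\<^sup>* x}"
    "set ws = {x. r \<rightarrow>\<^sup>* x} \<or> card (verts G) - 1 < card (set ws)"
    using ex_tour[OF assms] by blast
  have sub: "{x. r \<rightarrow>\<^sup>* x} \<subseteq> verts G" by (auto dest: reachable_in_verts)
  have "set ws = {x. r \<rightarrow>\<^sup>* x}" if "card (verts G) - 1 < card (set ws)"
  proof -
    have "set ws = verts G"
      using that ws(3) sub by (intro card_seteq) auto
    with ws(3) sub show ?thesis by blast
  qed
  with ws show ?thesis by blast
qed

section \<open>The graph of labels\<close>

text \<open>One bounded entry suffices for finiteness, as the others are within distance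
  \<open>m\<close> of it. It is the last one because the count extends lists at the front.\<close>

definition lipschitz_lists :: "nat \<Rightarrow> nat \<Rightarrow> int list set" where
  "lipschitz_lists n m = {ds. length ds = Suc m \<and> last ds \<in> {0..<int n} \<and>
     successively (\<lambda>x y. \<bar>x - y\<bar> \<le> 1) ds}"

text \<open>A longer list is determined by its tail and the difference of its first two entries,
  which is -1, 0 or 1.\<close>

lemma finite_card_lipschitz_lists:
  "finite (lipschitz_lists n m) \<and> card (lipschitz_lists n m) \<le> n * 3 ^ m"
proof (induction m)
  case 0
  have "lipschitz_lists n 0 = (\<lambda>d. [d]) ` {0..<int n}"
    by (auto simp: lipschitz_lists_def length_Suc_conv)
  then show ?case by (simp add: card_image inj_on_def)
next
  case (Suc m)
  let ?A = "{-1, 0, 1 :: int} \<times> lipschitz_lists n m"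
  let ?g = "\<lambda>(d, ds). (hd ds + d) # ds"
  have "lipschitz_lists n (Suc m) \<subseteq> ?g ` ?A"
  proof
    fix xs assume xs: "xs \<in> lipschitz_lists n (Suc m)"
    then obtain x y ys where eq: "xs = x # y # ys"
      by (auto simp: lipschitz_lists_def length_Suc_conv)
    have "(x - y, y # ys) \<in> ?A" using xs by (auto simp: eq lipschitz_lists_def)
    moreover have "xs = ?g (x - y, y # ys)" by (simp add: eq)
    ultimately show "xs \<in> ?g ` ?A" by (rule rev_image_eqI)
  qed
  moreover have "finite ?A" using Suc by simp
  ultimately have "finite (lipschitz_lists n (Suc m))"
    "card (lipschitz_lists n (Suc m)) \<le> card ?A"
    by (auto intro: finite_surj surj_card_le)
  then show ?case using Suc by (simp add: card_cartesian_product)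
qed

text \<open>The first component selects one of \<open>n\<close> disjoint copies; different
  components of an embedded graph are sent to different copies.\<close>

definition labels :: "nat \<Rightarrow> nat \<Rightarrow> (nat \<times> int list) set" where
  "labels n m = {..<n} \<times> lipschitz_lists n m"

text \<open>Sup-distance as a relation: labels in different copies are related for no
  \<open>k\<close>, which models infinite distance.\<close>

definition label_dist_le :: "nat \<Rightarrow> nat \<times> int list \<Rightarrow> nat \<times> int list \<Rightarrow> bool" where
  "label_dist_le k x y \<longleftrightarrow> fst x = fst y \<and>
     list_all2 (\<lambda>s t. \<bar>s - t\<bar> \<le> int k) (snd x) (snd y)"

lemma label_dist_le_refl: "label_dist_le k x x"
  by (simp add: label_dist_le_def list_all2_same)

lemma label_dist_le_sym: "label_dist_le k x y \<Longrightarrow> label_dist_le k y x"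
  by (auto simp: label_dist_le_def list_all2_conv_all_nth abs_minus_commute)

lemma label_dist_le_trans:
  assumes "label_dist_le j x y" "label_dist_le k y z"
  shows "label_dist_le (j + k) x z"
proof -
  have "list_all2 (\<lambda>s t. \<bar>s - t\<bar> \<le> int (j + k)) (snd x) (snd z)"
    by (rule list_all2_trans[of "\<lambda>s t. \<bar>s - t\<bar> \<le> int j" "\<lambda>s t. \<bar>s - t\<bar> \<le> int k"])
      (use assms in \<open>auto simp: label_dist_le_def\<close>)
  with assms show ?thesis by (simp add: label_dist_le_def)
qed

definition label_graph :: "nat \<Rightarrow> nat \<Rightarrow> (nat, nat \<times> nat) pre_digraph" where
  "label_graph n m = \<lparr>verts = to_nat ` labels n m,
     arcs = {(to_nat x, to_nat y) | x y. x \<in> labels n m \<and> y \<in> labels n m \<and> x \<noteq> y \<and>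
       label_dist_le 1 x y},
     tail = fst, head = snd\<rparr>"

lemma label_graph_sel [simp]:
  "verts (label_graph n m) = to_nat ` labels n m"
  "tail (label_graph n m) = fst"
  "head (label_graph n m) = snd"
  by (simp_all add: label_graph_def)

lemma in_arcs_label_graph:
  "e \<in> arcs (label_graph n m) \<longleftrightarrow> (\<exists>x y. e = (to_nat x, to_nat y) \<and> x \<in> labels n m \<and>
     y \<in> labels n m \<and> x \<noteq> y \<and> label_dist_le 1 x y)"
  by (auto simp: label_graph_def)

lemma finite_labels: "finite (labels n m)"
  using finite_card_lipschitz_lists by (simp add: labels_def)

lemma card_verts_label_graph: "card (verts (label_graph n m)) \<le> n * (n * 3 ^ m)"
proof -
  have "card (verts (label_graph n m)) \<le> card (labels n m)"
    using finite_labels by (simp add: card_image_le)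
  also have "\<dots> \<le> n * (n * 3 ^ m)"
    using finite_card_lipschitz_lists[of n m] by (simp add: labels_def card_cartesian_product)
  finally show ?thesis .
qed

lemma graph_label_graph: "graph (label_graph n m)"
proof -
  have "finite (arcs (label_graph n m))"
    by (rule finite_subset[of _ "to_nat ` labels n m \<times> to_nat ` labels n m"])
      (auto simp: in_arcs_label_graph finite_labels)
  moreover have "symmetric (label_graph n m)"
    unfolding symmetric_conv
  proof
    fix e assume "e \<in> arcs (label_graph n m)"
    then obtain x y where e: "e = (to_nat x, to_nat y)" and xy: "x \<in> labels n m"
      "y \<in> labels n m" "y \<noteq> x" "label_dist_le 1 x y"
      by (auto simp: in_arcs_label_graph)
    have "(to_nat y, to_nat x) \<in> arcs (label_graph n m)"
      unfolding in_arcs_label_graph using xy label_dist_le_sym by blast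
    then show "\<exists>e'\<in>arcs (label_graph n m). tail (label_graph n m) e = head (label_graph n m) e' \<and>
        head (label_graph n m) e = tail (label_graph n m) e'"
      by (rule rev_bexI) (simp add: e)
  qed
  ultimately show ?thesis
    by unfold_locales (auto simp: in_arcs_label_graph arc_to_ends_def finite_labels)
qed

text \<open>By the triangle inequality, since each arc contributes at most 1. Hence the label graph
  offers no shortcuts.\<close>

lemma label_dist_le_length_awalk:
  assumes "pre_digraph.awalk (label_graph n m) (to_nat x) p (to_nat y)"
  shows "label_dist_le (length p) x y"
proof -
  interpret graph "label_graph n m" by (rule graph_label_graph)
  show ?thesis
    using assms
  proof (induction p arbitrary: x)
    case Nil
    then show ?case by (auto simp: awalk_Nil_iff label_dist_le_refl)
  next
    case (Cons e p)
    then obtain z where "label_dist_le 1 x z" "awalk (to_nat z) p (to_nat y)"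
      by (auto simp: awalk_Cons_iff in_arcs_label_graph)
    with Cons.IH show ?case using label_dist_le_trans[of 1 x z "length p" y] by simp
  qed
qed

section \<open>Isometric embedding\<close>

text \<open>The second property makes \<phi> preserve arcs once it is injective; the third turns
  closeness of labels back into short walks, and its case \<open>k = 0\<close> yields
  injectivity.\<close>

lemma (in graph) ex_isometric_labelling:
  assumes "card (verts G) = n"
  obtains \<phi> :: "'a \<Rightarrow> nat \<times> int list" where
    "\<And>u. u \<in> verts G \<Longrightarrow> \<phi> u \<in> labels n (2 * (n - 1))"
    "\<And>u v. u \<rightarrow>\<^bsub>G\<^esub> v \<Longrightarrow> label_dist_le 1 (\<phi> u) (\<phi> v)"
    "\<And>u v k. \<lbrakk>u \<in> verts G; v \<in> verts G; label_dist_le k (\<phi> u) (\<phi> v)\<rbrakk> \<Longrightarrow>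
       \<exists>p. awalk u p v \<and> length p \<le> k"
proof -
  obtain h where h: "bij_betw h (verts G) {0..<n}"
    using ex_bij_betw_finite_nat[OF finite_verts] assms by blast
  \<comment> \<open>Vertices of one component satisfy the same predicate under \<open>SOME\<close>,
    so they share a representative and thereby a tour.\<close>
  define rep where "rep u = (SOME x. u \<rightarrow>\<^sup>* x)" for u
  have rep: "u \<rightarrow>\<^sup>* rep u" if "u \<in> verts G" for u
    unfolding rep_def by (rule someI[of _ u]) (use that in blast)
  have rep_verts: "rep u \<in> verts G" if "u \<in> verts G" for u
    using rep[OF that] by (rule reachable_in_verts)
  have rep_cong: "rep u = rep v" if "u \<rightarrow>\<^sup>* v" for u v
  proof -
    have "(u \<rightarrow>\<^sup>* x) = (v \<rightarrow>\<^sup>* x)" for x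
      using that by (blast intro: reachable_trans dest: symmetric_reachable')
    then show ?thesis by (simp add: rep_def)
  qed
  have reach: "u \<rightarrow>\<^sup>* v" if "rep u = rep v" "u \<in> verts G" "v \<in> verts G" for u v
    using rep[of u] rep[of v] that by (auto intro: reachable_trans dest: symmetric_reachable')
  have "\<forall>r\<in>verts G. \<exists>ws. length ws = Suc (2 * (n - 1)) \<and>
      successively (\<lambda>x y. x = y \<or> x \<rightarrow>\<^bsub>G\<^esub> y) ws \<and> set ws = {x. r \<rightarrow>\<^sup>* x}"
    using ex_covering_tour by (simp add: assms)
  from bchoice[OF this] obtain W where W: "length (W r) = Suc (2 * (n - 1))"
    "successively (\<lambda>x y. x = y \<or> x \<rightarrow>\<^bsub>G\<^esub> y) (W r)" "set (W r) = {x. r \<rightarrow>\<^sup>* x}"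
    if "r \<in> verts G" for r
    by blast
  have W_reach: "u \<rightarrow>\<^sup>* x" if "u \<in> verts G" "x \<in> set (W (rep u))" for u x
    using that rep[of u] W(3)[of "rep u"] rep_verts[of u] by (auto intro: reachable_trans)
  define \<phi> where "\<phi> u = (h (rep u), map (\<lambda>x. int (hops u x)) (W (rep u)))" for u
  show thesis
  proof
    fix u assume u: "u \<in> verts G"
    have r: "rep u \<in> verts G" using u by (rule rep_verts)
    have "W (rep u) \<noteq> []" using W(1)[OF r] by auto
    then have "last (W (rep u)) \<in> set (W (rep u))" by simp
    then have "hops u (last (W (rep u))) < n"
      using W_reach[OF u] hops_less_card assms by blast
    \<comment> \<open>Neighbouring tour vertices have distances from \<open>u\<close> differing by
      at most 1; symmetry of the arcs gives both inequalities.\<close>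
    moreover have "successively (\<lambda>x y. \<bar>int (hops u x) - int (hops u y)\<bar> \<le> 1) (W (rep u))"
    proof (rule successively_mono[OF W(2)[OF r]])
      fix x y assume xy: "x \<in> set (W (rep u))" "y \<in> set (W (rep u))" "x = y \<or> x \<rightarrow>\<^bsub>G\<^esub> y"
      have "\<bar>int (hops u x) - int (hops u y)\<bar> \<le> 1" if "x \<rightarrow>\<^bsub>G\<^esub> y"
        using hops_adj_right[of u x y] hops_adj_right[of u y x] W_reach[OF u xy(1)] W_reach[OF u xy(2)]
          that arcs_ends_symmetric[OF sym_arcs that] by linarith
      with xy(3) show "\<bar>int (hops u x) - int (hops u y)\<bar> \<le> 1" by auto
    qed
    moreover have "h (rep u) < n" using r h by (auto dest: bij_betwE)
    ultimately show "\<phi> u \<in> labels n (2 * (n - 1))"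
      using W(1)[OF r] \<open>W (rep u) \<noteq> []\<close>
      by (auto simp: \<phi>_def labels_def lipschitz_lists_def last_map successively_map)
  next
    fix u v assume uv: "u \<rightarrow>\<^bsub>G\<^esub> v"
    have vu: "v \<rightarrow>\<^bsub>G\<^esub> u" using uv by (rule arcs_ends_symmetric[OF sym_arcs])
    have verts: "u \<in> verts G" "v \<in> verts G" using adj_in_verts[OF uv] by auto
    have eq: "rep u = rep v" using uv by (intro rep_cong) auto
    have "\<bar>int (hops u x) - int (hops v x)\<bar> \<le> 1" if x: "x \<in> set (W (rep v))" for x
      using hops_adj_left[OF uv, of x] hops_adj_left[OF vu, of x] W_reach[of u x] W_reach[of v x]
        x eq verts by auto
    then show "label_dist_le 1 (\<phi> u) (\<phi> v)"
      by (simp add: \<phi>_def label_dist_le_def eq list_all2_map1 list_all2_map2 list_all2_same)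
  next
    fix u v k assume verts: "u \<in> verts G" "v \<in> verts G" and le: "label_dist_le k (\<phi> u) (\<phi> v)"
    \<comment> \<open>Equal copy numbers mean the same component, as \<open>h\<close> is injective;
      so both labels are taken along the same tour.\<close>
    have "h (rep u) = h (rep v)" using le by (simp add: label_dist_le_def \<phi>_def)
    then have eq: "rep u = rep v"
      using h rep_verts verts by (auto simp: bij_betw_def dest: inj_onD)
    \<comment> \<open>The tour visits \<open>v\<close>. At that position the label of
      \<open>v\<close> has entry 0 and that of \<open>u\<close> has the distance from
      \<open>u\<close> to \<open>v\<close>, which is therefore at most \<open>k\<close>.\<close>
    have "v \<in> set (W (rep v))"
      using W(3)[OF rep_verts[OF verts(2)]] rep[OF verts(2)] by (auto dest: symmetric_reachable')
    then have "\<bar>int (hops u v) - int (hops v v)\<bar> \<le> int k"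
      using le by (simp add: \<phi>_def label_dist_le_def eq list_all2_map1 list_all2_map2 list_all2_same)
    then have "hops u v \<le> k" using hops_refl[OF verts(2)] by simp
    then show "\<exists>p. awalk u p v \<and> length p \<le> k"
      using hops_awalk[OF reach[OF eq verts]] by metis
  qed
qed

lemma (in wf_digraph) graph_dist_eq_INF:
  "graph_dist G u v = (INF p\<in>{p. awalk u p v}. ereal (real (length p)))"
proof -
  have "awalk_cost (\<lambda>_. 1) p = real (length p)" for p :: "'b list"
    by (induction p) auto
  then show ?thesis by (simp add: graph_dist_def \<mu>_def)
qed

text \<open>Walks of the subgraph are walks of \<open>H\<close>, which gives one inequality;
  \<open>shortcut\<close> gives the other. Comparing infima over walks also covers infinite
  distances.\<close>

lemma isometric_subgraphI:
  assumes sub: "subgraph G H"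
    and shortcut: "\<And>u v q. \<lbrakk>u \<in> verts G; v \<in> verts G; pre_digraph.awalk H u q v\<rbrakk> \<Longrightarrow>
      \<exists>p. pre_digraph.awalk G u p v \<and> length p \<le> length q"
  shows "isometric_subgraph G H"
  unfolding isometric_subgraph_def
proof (intro conjI ballI)
  interpret G: wf_digraph G using sub by (simp add: subgraph_def)
  interpret H: wf_digraph H using sub by (simp add: subgraph_def)
  fix u v assume uv: "u \<in> verts G" "v \<in> verts G"
  show "graph_dist G u v = graph_dist H u v"
    unfolding G.graph_dist_eq_INF H.graph_dist_eq_INF
  proof (intro antisym INF_mono)
    fix q assume "q \<in> {q. H.awalk u q v}"
    then show "\<exists>p\<in>{p. G.awalk u p v}. ereal (real (length p)) \<le> ereal (real (length q))"
      using shortcut[OF uv] by auto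
  next
    fix p assume "p \<in> {p. G.awalk u p v}"
    then show "\<exists>q\<in>{q. H.awalk u q v}. ereal (real (length q)) \<le> ereal (real (length p))"
      using H.subgraph_awalk_imp_awalk[OF _ sub] by blast
  qed
qed (rule sub)

lemma has_isometric_copy_label_graph:
  assumes "G \<in> n_vertex_graphs n"
  shows "has_isometric_copy (label_graph n (2 * (n - 1))) G"
proof -
  interpret graph G using assms by (simp add: n_vertex_graphs_def)
  let ?H = "label_graph n (2 * (n - 1))"
  interpret H: graph ?H by (rule graph_label_graph)
  obtain \<phi> where \<phi>: "\<And>u. u \<in> verts G \<Longrightarrow> \<phi> u \<in> labels n (2 * (n - 1))"
    "\<And>u v. u \<rightarrow>\<^bsub>G\<^esub> v \<Longrightarrow> label_dist_le 1 (\<phi> u) (\<phi> v)"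
    "\<And>u v k. \<lbrakk>u \<in> verts G; v \<in> verts G; label_dist_le k (\<phi> u) (\<phi> v)\<rbrakk> \<Longrightarrow>
       \<exists>p. awalk u p v \<and> length p \<le> k"
    using ex_isometric_labelling[of n] assms unfolding n_vertex_graphs_def by blast
  have inj: "u = v" if "u \<in> verts G" "v \<in> verts G" "\<phi> u = \<phi> v" for u v
    using \<phi>(3)[of u v 0] that label_dist_le_refl by (auto simp: awalk_Nil_iff)
  define f where "f u = to_nat (\<phi> u)" for u
  define hom where "hom = \<lparr>iso_verts = f, iso_arcs = (\<lambda>a. (f (tail G a), f (head G a))),
    iso_head = snd, iso_tail = fst\<rparr>"
  have inj_f: "inj_on f (verts G)" using inj by (auto simp: f_def inj_on_def)
  have "inj_on (\<lambda>a. (f (tail G a), f (head G a))) (arcs G)"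
    by (rule inj_onI)
      (auto intro!: no_multi_arcs simp: arc_to_ends_def dest!: inj_onD[OF inj_f])
  then have hom: "digraph_isomorphism hom"
    using inj_f wf_digraph by (auto simp: digraph_isomorphism_def hom_def)
  let ?G' = "app_iso hom G"
  have "arcs ?G' \<subseteq> arcs ?H"
  proof
    fix e assume "e \<in> arcs ?G'"
    then obtain a where a: "a \<in> arcs G" "e = (f (tail G a), f (head G a))"
      by (auto simp: hom_def)
    then have "\<phi> (tail G a) \<noteq> \<phi> (head G a)" using inj no_loops by (meson head_in_verts tail_in_verts)
    with a \<phi> show "e \<in> arcs ?H"
      by (auto simp: in_arcs_label_graph f_def intro!: in_arcs_imp_in_arcs_ends)
  qed
  moreover have "verts ?G' \<subseteq> verts ?H" using \<phi>(1) by (auto simp: hom_def f_def)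
  ultimately have "subgraph ?G' ?H"
    using wf_digraphI_app_iso[OF hom] H.wf_digraph
    by (auto simp: subgraph_def compatible_def hom_def)
  then have "isometric_subgraph ?G' ?H"
  proof (rule isometric_subgraphI)
    fix a b q assume ab: "a \<in> verts ?G'" "b \<in> verts ?G'" and q: "H.awalk a q b"
    obtain u v where uv: "u \<in> verts G" "v \<in> verts G" "a = iso_verts hom u" "b = iso_verts hom v"
      using ab by auto
    \<comment> \<open>A walk of the label graph bounds the label distance of its ends, which yields
      a walk of \<open>G\<close> at most as long; its image lies in the copy.\<close>
    have "label_dist_le (length q) (\<phi> u) (\<phi> v)"
      using q label_dist_le_length_awalk by (simp add: uv hom_def f_def)
    then obtain p where p: "awalk u p v" "length p \<le> length q" using \<phi>(3) uv by blast
    have "pre_digraph.awalk ?G' a (map (iso_arcs hom) p) b"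
      unfolding uv using p(1) hom by (rule awalk_app_isoI)
    with p(2) show "\<exists>p. pre_digraph.awalk ?G' a p b \<and> length p \<le> length q"
      by (metis length_map)
  qed
  then show ?thesis using hom by (auto simp: has_isometric_copy_def digraph_iso_def)
qed

theorem theorem2p5:
  shows "\<exists>(C :: real) (f :: nat \<Rightarrow> real).
    (\<forall>n \<ge> 2. \<bar>f n\<bar> \<le> C * log 2 (real n)) \<and>
    (\<forall>n \<ge> 1. \<exists>H :: (nat, nat \<times> nat) pre_digraph.
        isometric_universal H (n_vertex_graphs n :: (nat, nat \<times> nat) pre_digraph set) \<and>
        real (card (verts H)) \<le> 16 powr (real n + f n))"
proof (intro exI conjI allI impI)
  fix n :: nat assume "2 \<le> n"
  \<comment> \<open>This fixes the witnesses \<open>C = 1\<close> and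
    \<open>f n = log 2 n\<close>.\<close>
  then show "\<bar>log 2 (real n)\<bar> \<le> 1 * log 2 (real n)" by simp
next
  fix n :: nat assume n: "1 \<le> n"
  let ?H = "label_graph n (2 * (n - 1))"
  show "isometric_universal ?H (n_vertex_graphs n :: (nat, nat \<times> nat) pre_digraph set)"
    using graph_label_graph has_isometric_copy_label_graph by (auto simp: isometric_universal_def)
  have "(3::nat) ^ (2 * (n - 1)) \<le> 9 ^ n"
    by (simp add: power_mult power_increasing)
  also have "\<dots> \<le> 16 ^ n" by (rule power_mono) auto
  finally have "n * (n * 3 ^ (2 * (n - 1))) \<le> n ^ 4 * 16 ^ n"
    \<comment> \<open>The factor \<open>n^2\<close> is rounded up to \<open>n^4\<close> because
      \<open>n^4\<close> is exactly 16 to the power \<open>log 2 n\<close>.\<close>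
    using n self_le_power[of "n\<^sup>2" 2]
    by (simp add: mult_mono power2_eq_square power4_eq_xxxx flip: mult.assoc)
  then have "card (verts ?H) \<le> n ^ 4 * 16 ^ n"
    using card_verts_label_graph order_trans by blast
  then have "real (card (verts ?H)) \<le> real (n ^ 4 * 16 ^ n)" by (rule of_nat_mono)
  also have "\<dots> = 16 powr real n * 16 powr log 2 (real n)"
  proof -
    have "(16::real) powr log 2 (real n) = (2 powr log 2 (real n)) powr 4"
      by (simp add: powr_powr_swap)
    then show ?thesis using n by (simp add: powr_realpow)
  qed
  finally show "real (card (verts ?H)) \<le> 16 powr (real n + log 2 (real n))"
    by (simp add: powr_add)
qed

end
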